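(* There exists a uniform constant $C>0$ (it is enough to take $C=2^{-14}$) such that for any integers $n,m\ge 4$ there exists an oriented graph $G=(V,E)$ with $|V|=n$ and $|E|=m$ such that $$\nu(G)\ge C\cdot\bigl(\min(|V|^2,|E|)\cdot\min(|V|,|E|)\bigr).$$
   Context: An oriented graph $G=(V,E)$ is a pair of finite nonempty sets (vertices and edges) with two functions $t,o:E\to V$ giving the tail (end point) $t(e)$ and the origin (starting point) $o(e)$ of each edge; loops and multiple edges are allowed. A diagram $(G,l)$ over a monoid $M$ is an oriented graph $G$ with a labeling $l:E\to M$. For a finite sequence $s=(e_1,\dots,e_k)$ of edges (not necessarily consecutive) put $l(s)=l(e_1)\cdots l(e_k)$, and $l(())=\mathbf 1_M$ for the empty sequence. A path $p$ is a (possibly empty) edge sequence $(e_1,\dots,e_k)$ with $t(e_i)=o(e_{i+1})$ for $1\le i\le k-1$, together with vertices $o(p),t(p)$ such that $o(p)=o(e_1)$, $t(p)=t(e_k)$ if $k>0$, and $o(p)=t(p)$ if $k=0$ (so there is a path of length zero at every vertex). The diagram is commutative if $l(p_1)=l(p_2)$ for all paths $p_1,p_2$ with $o(p_1)=o(p_2)$ and $t(p_1)=t(p_2)$. A system of relations for $G$ is a finite set $\mathcal R=\{(s_1,s_1'),\dots,(s_k,s_k')\}$ of pairs of (not necessarily consecutive) edge sequences of $G$. It is complete if for every monoid $M$ and every labeling $l:E\to M$, the diagram $(G,l)$ is commutative if and only if $l(s_i)=l(s_i')$ for all $i$. For finite sets $S,S'$ of edge sequences, $S'$ is obtained from $S$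 by a multiplication if $S'=S\cup\{s\circ s'\}$ with $s,s'\in S$, where $\circ$ is concatenation. Let $m(S,S')\in\mathbb N\cup\{\infty\}$ be the minimal number of successive multiplications needed to obtain $S'$ from $S$. For a system of relations $\mathcal R$ put $S_{\mathcal R}=\bigcup_{(s,s')\in\mathcal R}\{s,s'\}$, $\mathcal E=\{(e):e\in E\}\cup\{()\}$, and $m(\mathcal R)=\min_{S\supseteq S_{\mathcal R}}m(\mathcal E,S)$. The multiplication rank is $\nu(G)=\min_{\mathcal R}m(\mathcal R)$, the minimum over all complete systems of relations for $G$. (The function $m(\cdot)$ is unrelated to the integer $m$ in the claim.) *)

theory Defs
  imports
    "Graph_Theory.Arc_Walk"
    "HOL-Algebra.Group"
    "HOL-Library.Countable_Set"
    "HOL-Library.Extended_Real"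
begin

text \<open>
  The origin \<open>o(e)\<close> of an edge is \<^const>\<open>tail\<close>, and its end point \<open>t(e)\<close> (called
  ``tail'' in the source) is \<^const>\<open>head\<close>.  Paths from \<open>u\<close> to \<open>v\<close> are
  the arc walks \<open>pre_digraph.awalk G u p v\<close>, which include the empty walk at each vertex.
\<close>

locale oriented_graph = fin_digraph +
  assumes verts_nonempty: "verts G \<noteq> {}"
    and arcs_nonempty: "arcs G \<noteq> {}"

definition seq_label :: "('m, 'x) monoid_scheme \<Rightarrow> ('e \<Rightarrow> 'm) \<Rightarrow> 'e list \<Rightarrow> 'm" where
  "seq_label M l s = foldr (\<lambda>e x. l e \<otimes>\<^bsub>M\<^esub> x) s \<one>\<^bsub>M\<^esub>"

definition commutative_diagram ::
    "('m, 'x) monoid_scheme \<Rightarrow> ('v, 'e) pre_digraph \<Rightarrow> ('e \<Rightarrow> 'm) \<Rightarrow> bool" where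
  "commutative_diagram M G l \<longleftrightarrow>
    (\<forall>u v p q. pre_digraph.awalk G u p v \<longrightarrow> pre_digraph.awalk G u q v \<longrightarrow>
      seq_label M l p = seq_label M l q)"

definition relation_system :: "('v, 'e) pre_digraph \<Rightarrow> ('e list \<times> 'e list) set \<Rightarrow> bool" where
  "relation_system G R \<longleftrightarrow> finite R \<and> R \<subseteq> lists (arcs G) \<times> lists (arcs G)"

definition complete_over ::
    "'m itself \<Rightarrow> ('v, 'e) pre_digraph \<Rightarrow> ('e list \<times> 'e list) set \<Rightarrow> bool" where
  "complete_over (_ :: 'm itself) G R \<longleftrightarrow>
    (\<forall>(M :: 'm monoid) l. monoid M \<longrightarrow> l \<in> arcs G \<rightarrow> carrier M \<longrightarrow>
      (commutative_diagram M G l \<longleftrightarrow> (\<forall>(s, s') \<in> R. seq_label M l s = seq_label M l s')))"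

text \<open>
  HOL cannot quantify over all types inside a definition.  Only the submonoid generated by the
  finitely many labels matters and it is countable, so monoids whose carrier is a set
  of natural numbers suffice: see \<open>complete_system_over\<close> below, where the type \<open>'m\<close> is arbitrary.
\<close>

definition complete_system :: "('v, 'e) pre_digraph \<Rightarrow> ('e list \<times> 'e list) set \<Rightarrow> bool" where
  "complete_system G R \<longleftrightarrow> relation_system G R \<and> complete_over TYPE(nat) G R"

lemma seq_label_simps [simp]:
  "seq_label M l [] = \<one>\<^bsub>M\<^esub>"
  "seq_label M l (e # s) = l e \<otimes>\<^bsub>M\<^esub> seq_label M l s"
  by (simp_all add: seq_label_def)

lemma (in monoid) seq_label_closed:
  "l \<in> A \<rightarrow> carrier G \<Longrightarrow> s \<in> lists A \<Longrightarrow> seq_label G l s \<in> carrier G"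
  by (induction s) auto

lemma (in monoid) seq_label_append:
  "l \<in> A \<rightarrow> carrier G \<Longrightarrow> s \<in> lists A \<Longrightarrow> s' \<in> lists A \<Longrightarrow>
    seq_label G l (s @ s') = seq_label G l s \<otimes> seq_label G l s'"
proof (induction s)
  case Nil
  then show ?case by (simp add: seq_label_closed)
next
  case (Cons e s)
  moreover have "seq_label G l s \<in> carrier G" "seq_label G l s' \<in> carrier G"
    using Cons.prems by (auto intro: seq_label_closed)
  moreover have "l e \<in> carrier G" using Cons.prems by auto
  ultimately show ?case by (auto simp: m_assoc)
qed

lemma complete_over_transfer:
  fixes G :: "('v, 'e) pre_digraph"
  assumes fin: "finite (arcs G)" and R: "R \<subseteq> lists (arcs G) \<times> lists (arcs G)"
    and nat: "complete_over TYPE(nat) G R"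
  shows "complete_over TYPE('m) G R"
  unfolding complete_over_def
proof (intro allI impI)
  fix M :: "'m monoid" and l
  assume "monoid M" and l: "l \<in> arcs G \<rightarrow> carrier M"
  interpret monoid M by fact
  define H where "H = seq_label M l ` lists (arcs G)"
  define f where "f = to_nat_on H"
  define g where "g = inv_into H f"
  define N where "N = \<lparr>carrier = f ` H, mult = (\<lambda>a b. f (g a \<otimes>\<^bsub>M\<^esub> g b)), one = f \<one>\<^bsub>M\<^esub>\<rparr>"
  have "countable H"
    unfolding H_def using fin by (intro countable_image countable_lists countable_finite)
  then have inj: "inj_on f H" by (simp add: f_def inj_on_to_nat_on)
  then have gf: "g (f x) = x" if "x \<in> H" for x using that by (simp add: g_def)
  have HM: "H \<subseteq> carrier M" using l by (auto simp: H_def intro: seq_label_closed)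
  have one: "\<one>\<^bsub>M\<^esub> \<in> H" unfolding H_def by (rule image_eqI[of _ _ "[]"]) auto
  have mult: "x \<otimes>\<^bsub>M\<^esub> y \<in> H" if "x \<in> H" "y \<in> H" for x y
  proof -
    from that obtain s s' where "s \<in> lists (arcs G)" "s' \<in> lists (arcs G)"
      "x = seq_label M l s" "y = seq_label M l s'" by (auto simp: H_def)
    then have "x \<otimes>\<^bsub>M\<^esub> y = seq_label M l (s @ s')" "s @ s' \<in> lists (arcs G)"
      using seq_label_append[OF l] by auto
    then show ?thesis by (auto simp: H_def)
  qed
  have N: "monoid N"
    using HM by unfold_locales (auto simp: N_def gf one mult m_assoc subset_iff)
  have lH: "l e \<in> H" if "e \<in> arcs G" for e
    unfolding H_def using that funcset_mem[OF l that]
    by (intro image_eqI[of _ _ "[e]"]) simp_all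
  have lN: "f \<circ> l \<in> arcs G \<rightarrow> carrier N" using lH by (auto simp: N_def)
  have eq: "seq_label N (f \<circ> l) s = f (seq_label M l s)" if "s \<in> lists (arcs G)" for s
    using that
  proof (induction s)
    case (Cons e s)
    then have "seq_label M l s \<in> H" by (auto simp: H_def)
    with Cons show ?case by (simp add: N_def gf lH)
  qed (simp add: N_def)
  have iff: "seq_label N (f \<circ> l) s = seq_label N (f \<circ> l) s' \<longleftrightarrow> seq_label M l s = seq_label M l s'"
    if "s \<in> lists (arcs G)" "s' \<in> lists (arcs G)" for s s'
    using that inj by (auto simp: eq H_def inj_on_eq_iff)
  have walk: "p \<in> lists (arcs G)" if "pre_digraph.awalk G u p v" for u p v
    using that by (auto simp: pre_digraph.awalk_def)
  have "commutative_diagram N G (f \<circ> l) \<longleftrightarrow> commutative_diagram M G l"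
    unfolding commutative_diagram_def using iff[OF walk walk] by blast
  moreover have "(\<forall>(s, s') \<in> R. seq_label N (f \<circ> l) s = seq_label N (f \<circ> l) s') \<longleftrightarrow>
      (\<forall>(s, s') \<in> R. seq_label M l s = seq_label M l s')"
  proof (intro ball_cong refl)
    fix r assume "r \<in> R"
    then obtain s s' where "r = (s, s')" "s \<in> lists (arcs G)" "s' \<in> lists (arcs G)"
      using R by blast
    then show "(case r of (s, s') \<Rightarrow> seq_label N (f \<circ> l) s = seq_label N (f \<circ> l) s') \<longleftrightarrow>
        (case r of (s, s') \<Rightarrow> seq_label M l s = seq_label M l s')"
      by (simp only: prod.case iff)
  qed
  ultimately show "commutative_diagram M G l \<longleftrightarrow>
      (\<forall>(s, s') \<in> R. seq_label M l s = seq_label M l s')"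
    using nat N lN unfolding complete_over_def by blast
qed

lemma complete_system_over:
  assumes "oriented_graph G" and "complete_system G R"
  shows "complete_over TYPE('m) G R"
proof -
  interpret oriented_graph G by fact
  show ?thesis
    using assms(2) complete_over_transfer[OF finite_arcs]
    by (auto simp: complete_system_def relation_system_def)
qed

definition multiplication_step :: "'e list set \<Rightarrow> 'e list set \<Rightarrow> bool" where
  "multiplication_step S S' \<longleftrightarrow> (\<exists>s\<in>S. \<exists>s'\<in>S. S' = S \<union> {s @ s'})"

text \<open>In \<^typ>\<open>enat\<close> an infimum over a nonempty set is a minimum; over the empty set it is \<open>\<infinity>\<close>.\<close>

definition num_mults :: "'e list set \<Rightarrow> 'e list set \<Rightarrow> enat" where
  "num_mults S S' = (INF k \<in> {k. (multiplication_step ^^ k) S S'}. enat k)"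

definition relation_seqs :: "('e list \<times> 'e list) set \<Rightarrow> 'e list set" where
  "relation_seqs R = (\<Union>(s, s')\<in>R. {s, s'})"

definition short_seqs :: "('v, 'e) pre_digraph \<Rightarrow> 'e list set" where
  "short_seqs G = {[e] | e. e \<in> arcs G} \<union> {[]}"

definition system_mults :: "('v, 'e) pre_digraph \<Rightarrow> ('e list \<times> 'e list) set \<Rightarrow> enat" where
  "system_mults G R =
    (INF S \<in> {S. finite S \<and> S \<subseteq> lists (arcs G) \<and> relation_seqs R \<subseteq> S}.
      num_mults (short_seqs G) S)"

definition multiplication_rank :: "('v, 'e) pre_digraph \<Rightarrow> enat" where
  "multiplication_rank G = (INF R \<in> {R. complete_system G R}. system_mults G R)"

end

theory Submission
  imports Defs "HOL-Library.Sublist"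
begin

text \<open>
  Two observations give a lower bound for the multiplication rank of every oriented graph.

  First, some paths occur in every complete system of relations.  Suppose that \<open>p\<close> is parallel to
  a different path while no proper factor of \<open>p\<close> is.  The relations in a complete system hold in
  every commutative diagram, so the only way in which they could force \<open>p\<close> to have the same label as
  its rival is by rewriting \<open>p\<close> itself: no proper factor of \<open>p\<close> can be rewritten.  To make this
  precise without analysing derivations, label each edge by its class in the free monoid with all
  sequences outside a factor-closed set \<open>F\<close> collapsed to one zero.  That diagram is commutative iff
  \<open>F\<close> contains no path with a different parallel path.  The proper factors of \<open>p\<close> give a
  commutative diagram and all factors of \<open>p\<close> a noncommutative one, but the two labelings
  identify the same sequences other than \<open>p\<close>; hence some relation has \<open>p\<close> as one of its sides
  (\<open>minimally_ambiguous_in_relation_seqs\<close>).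

  Secondly, a multiplication creates the single sequence \<open>s \<circ> s'\<close>, in which the only consecutive
  pair of edges that is possibly new is the one at the seam.  The sequences of length at most
  one have no consecutive pairs, so the multiplication rank is at least the number of different
  consecutive pairs in the unavoidable paths (\<open>multiplication_rank_ge\<close>).

  Now take three layers of \<open>p\<close>, \<open>q\<close> and \<open>p\<close> vertices and join neighbouring layers completely.
  This uses \<open>2 p q\<close> edges, and for \<open>q \<ge> 2\<close> each of the \<open>p q p\<close> paths of length two through all
  layers is unavoidable.  Isolated vertices and parallel edges from a fixed vertex of the first layer
  to a fixed vertex of the last one adjust the numbers of vertices and edges
  without affecting this (\<open>multiplication_rank_layered_ge\<close>).  With \<open>K = min n\<^sup>2 m\<close> and
  \<open>L = min n m\<close>, sizes \<open>p\<close> of order \<open>L\<close> and \<open>q\<close> of order \<open>K / L\<close> fit and make \<open>p q p\<close> at least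
  \<open>K L / 256\<close> (\<open>layer_sizes_exist\<close>), which is better than the required \<open>K L / 2\<^sup>1\<^sup>4\<close>.
\<close>

section \<open>Rees quotients of free monoids\<close>

definition factor_closed :: "'e list set \<Rightarrow> bool" where
  "factor_closed F \<longleftrightarrow> [] \<in> F \<and> (\<forall>s\<in>F. \<forall>s'. sublist s' s \<longrightarrow> s' \<in> F)"

text \<open>
  The quotient of the free monoid by the ideal of all words outside \<open>F\<close>; the value \<open>None\<close> is the
  zero to which that ideal collapses.
\<close>

definition rees_monoid :: "'e list set \<Rightarrow> 'e list option monoid" where
  "rees_monoid F = \<lparr>carrier = insert None (Some ` F),
    mult = (\<lambda>x y. case (x, y) of
      (Some s, Some s') \<Rightarrow> if s @ s' \<in> F then Some (s @ s') else None
    | _ \<Rightarrow> None),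
    one = Some []\<rparr>"

definition rees_class :: "'e list set \<Rightarrow> 'e list \<Rightarrow> 'e list option" where
  "rees_class F s = (if s \<in> F then Some s else None)"

lemma factor_closed_appendD:
  assumes "factor_closed F" "s @ s' \<in> F"
  shows "s \<in> F" "s' \<in> F"
  using assms unfolding factor_closed_def by auto

lemma monoid_rees_monoid:
  assumes F: "factor_closed F"
  shows "monoid (rees_monoid F)"
proof
  fix x y z
  show "x \<otimes>\<^bsub>rees_monoid F\<^esub> y \<otimes>\<^bsub>rees_monoid F\<^esub> z = x \<otimes>\<^bsub>rees_monoid F\<^esub> (y \<otimes>\<^bsub>rees_monoid F\<^esub> z)"
  proof (cases "x = None \<or> y = None \<or> z = None")
    case True
    then show ?thesis by (auto simp: rees_monoid_def split: option.splits)
  next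
    case False
    then obtain r s t where xyz: "x = Some r" "y = Some s" "z = Some t" by auto
    show ?thesis
    proof (cases "r @ s @ t \<in> F")
      case True
      then have "r @ s \<in> F" "s @ t \<in> F"
        using factor_closed_appendD[OF F, of "r @ s" t] factor_closed_appendD[OF F, of r "s @ t"]
        by simp_all
      with True show ?thesis by (simp add: xyz rees_monoid_def)
    qed (simp add: xyz rees_monoid_def)
  qed
qed (use F in \<open>auto simp: rees_monoid_def factor_closed_def split: option.splits\<close>)

text \<open>
  With the canonical labeling, a sequence is sent to its class.  Factor-closedness makes
  a product nonzero only if all of its partial products are.
\<close>

lemma seq_label_rees_monoid:
  assumes F: "factor_closed F"
  shows "seq_label (rees_monoid F) (\<lambda>e. rees_class F [e]) s = rees_class F s"
proof (induction s)
  case Nil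
  then show ?case using F by (simp add: rees_monoid_def rees_class_def factor_closed_def)
next
  case (Cons e s)
  then show ?case
    using factor_closed_appendD[OF F, of "[e]" s]
    by (auto simp: rees_monoid_def rees_class_def)
qed

section \<open>Paths that every complete system contains\<close>

definition ambiguous :: "('v, 'e) pre_digraph \<Rightarrow> 'e list \<Rightarrow> bool" where
  "ambiguous G p \<longleftrightarrow>
    (\<exists>u v q. pre_digraph.awalk G u p v \<and> pre_digraph.awalk G u q v \<and> q \<noteq> p)"

text \<open>
  The empty path must be excluded: if it is ambiguous, it has no proper factors, and the empty
  set of words does not define a Rees quotient with a unit.
\<close>

definition minimally_ambiguous :: "('v, 'e) pre_digraph \<Rightarrow> 'e list \<Rightarrow> bool" where
  "minimally_ambiguous G p \<longleftrightarrow>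
    p \<noteq> [] \<and> ambiguous G p \<and> (\<forall>p'. strict_sublist p' p \<longrightarrow> \<not> ambiguous G p')"

text \<open>
  A nonzero class contains a single sequence, so an ambiguous path in \<open>F\<close> is separated from its
  rival, while ambiguous paths outside \<open>F\<close> are all zero.
\<close>

lemma commutative_rees_diagram_iff:
  assumes "factor_closed F"
  shows "commutative_diagram (rees_monoid F) G (\<lambda>e. rees_class F [e]) \<longleftrightarrow>
    (\<forall>p\<in>F. \<not> ambiguous G p)"
  (is "?commutative \<longleftrightarrow> ?unambiguous")
proof
  assume comm: ?commutative
  show ?unambiguous
  proof
    fix p assume "p \<in> F"
    have "q = p" if "pre_digraph.awalk G u p v" "pre_digraph.awalk G u q v" for u v q
    proof -
      have "rees_class F p = rees_class F q"
        using comm that unfolding commutative_diagram_def seq_label_rees_monoid[OF assms] by blast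
      with \<open>p \<in> F\<close> show ?thesis by (simp add: rees_class_def split: if_splits)
    qed
    then show "\<not> ambiguous G p" by (auto simp: ambiguous_def)
  qed
next
  assume un: ?unambiguous
  have "rees_class F p = rees_class F q"
    if "pre_digraph.awalk G u p v" "pre_digraph.awalk G u q v" for u v p q
  proof (cases "p = q")
    case False
    then have "ambiguous G p" "ambiguous G q"
      using that unfolding ambiguous_def by metis+
    with un show ?thesis by (auto simp: rees_class_def)
  qed simp
  then show ?commutative
    unfolding commutative_diagram_def seq_label_rees_monoid[OF assms] by blast
qed

text \<open>
  Compare the quotient \<open>F\<close> given by the factors of \<open>p\<close> with the quotient \<open>F'\<close> given by its proper
  factors.  The second one is a commutative diagram, so it satisfies all relations.  If \<open>p\<close> were on
  neither side of any of them, the first one would satisfy them too, and completeness would make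
  it commutative although it separates \<open>p\<close> from a parallel path.
\<close>

lemma minimally_ambiguous_in_relation_seqs:
  assumes G: "oriented_graph G" and R: "complete_system G R" and p: "minimally_ambiguous G p"
  shows "p \<in> relation_seqs R"
proof (rule ccontr)
  assume not_in: "p \<notin> relation_seqs R"
  define F where "F = {s. sublist s p}"
  define F' where "F' = {s. strict_sublist s p}"
  have F: "factor_closed F"
    unfolding factor_closed_def F_def by (auto intro: sublist_order.order.trans)
  have F': "factor_closed F'"
    using p unfolding factor_closed_def F'_def minimally_ambiguous_def
    by (auto intro: sublist_order.order.strict_trans1 simp: strict_sublist_def)
  have complete: "(\<forall>s\<in>H. \<not> ambiguous G s) \<longleftrightarrow> (\<forall>(s, s')\<in>R. rees_class H s = rees_class H s')"
    if H: "factor_closed H" for H :: "'b list set"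
  proof -
    have "(\<lambda>e. rees_class H [e]) \<in> arcs G \<rightarrow> carrier (rees_monoid H)"
      by (auto simp: rees_class_def rees_monoid_def)
    then show ?thesis
      using complete_system_over[OF G R, where 'm = "'b list option"] monoid_rees_monoid[OF H]
      unfolding complete_over_def commutative_rees_diagram_iff[OF H, symmetric]
      by (simp add: seq_label_rees_monoid[OF H])
  qed
  have "\<forall>s\<in>F'. \<not> ambiguous G s"
    using p by (auto simp: F'_def minimally_ambiguous_def)
  then have R': "\<forall>(s, s')\<in>R. rees_class F' s = rees_class F' s'"
    using complete[OF F'] by simp
  \<comment> \<open>The two quotients differ only in the class of \<open>p\<close>, which occurs in no relation.\<close>
  have same: "rees_class F s = rees_class F' s" if "s \<noteq> p" for s
    using that by (auto simp: rees_class_def F_def F'_def strict_sublist_def)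
  have "\<forall>(s, s')\<in>R. rees_class F s = rees_class F s'"
  proof clarify
    fix s s' assume "(s, s') \<in> R"
    with not_in have "s \<noteq> p" "s' \<noteq> p" by (auto simp: relation_seqs_def)
    with R' \<open>(s, s') \<in> R\<close> show "rees_class F s = rees_class F s'" by (auto simp: same)
  qed
  then have "\<forall>s\<in>F. \<not> ambiguous G s"
    using complete[OF F] by simp
  then show False
    using p by (auto simp: F_def minimally_ambiguous_def)
qed

section \<open>Multiplications and consecutive pairs of edges\<close>

definition consecutive_pairs :: "'e list set \<Rightarrow> ('e \<times> 'e) set" where
  "consecutive_pairs S = {(e, f). \<exists>s\<in>S. sublist [e, f] s}"

text \<open>
  The exceptional pair is the one at the seam of the new product.
\<close>

lemma consecutive_pairs_step:
  assumes "multiplication_step S S'"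
  shows "\<exists>ef. consecutive_pairs S' \<subseteq> insert ef (consecutive_pairs S)"
proof -
  obtain s s' where s: "s \<in> S" "s' \<in> S" "S' = S \<union> {s @ s'}"
    using assms by (auto simp: multiplication_step_def)
  have "(e, f) = (last s, hd s') \<or> (e, f) \<in> consecutive_pairs S"
    if "sublist [e, f] (s @ s')" for e f
  proof -
    have "sublist [e, f] s \<or> sublist [e, f] s' \<or>
        (\<exists>xs ys. [e, f] = xs @ ys \<and> suffix xs s \<and> prefix ys s')"
      using that by (simp only: sublist_append)
    then show ?thesis
    proof (elim disjE exE conjE)
      fix xs ys
      assume split: "[e, f] = xs @ ys" "suffix xs s" "prefix ys s'"
      consider "xs = []" | "xs = [e]" | "xs = [e, f]"
        using split(1) by (cases xs; cases "tl xs") auto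
      then show ?thesis
      proof cases
        case 1
        with split s show ?thesis by (auto simp: consecutive_pairs_def)
      next
        case 2
        with split show ?thesis by (auto simp: suffix_def prefix_def)
      next
        case 3
        with split s show ?thesis by (auto simp: consecutive_pairs_def)
      qed
    qed (use s in \<open>auto simp: consecutive_pairs_def\<close>)
  qed
  then have "consecutive_pairs S' \<subseteq> insert (last s, hd s') (consecutive_pairs S)"
    using s by (auto simp: consecutive_pairs_def)
  then show ?thesis ..
qed

lemma card_consecutive_pairs_le:
  assumes "(multiplication_step ^^ k) S S'" "finite (consecutive_pairs S)"
  shows "finite (consecutive_pairs S') \<and>
    card (consecutive_pairs S') \<le> card (consecutive_pairs S) + k"
  using assms
proof (induction k arbitrary: S')
  case (Suc k)
  then obtain S1 where S1: "(multiplication_step ^^ k) S S1" "multiplication_step S1 S'"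
    by auto
  obtain ef where ef: "consecutive_pairs S' \<subseteq> insert ef (consecutive_pairs S1)"
    using consecutive_pairs_step[OF S1(2)] by blast
  have IH: "finite (consecutive_pairs S1)"
      "card (consecutive_pairs S1) \<le> card (consecutive_pairs S) + k"
    using Suc S1 by auto
  have "card (consecutive_pairs S') \<le> card (insert ef (consecutive_pairs S1))"
    using ef IH by (intro card_mono) auto
  also have "\<dots> \<le> Suc (card (consecutive_pairs S1))"
    by (simp add: card_insert_le_m1 card_insert_if IH)
  finally show ?case
    using IH ef by (auto intro: finite_subset)
qed simp

text \<open>
  The multiplications start from sequences of length at most one and must reach every
  minimally ambiguous path, so every consecutive pair in such a path has to appear on the way.
\<close>

theorem multiplication_rank_ge:
  assumes G: "oriented_graph G"
    and T: "T \<subseteq> consecutive_pairs {p. minimally_ambiguous G p}"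
  shows "enat (card T) \<le> multiplication_rank G"
  unfolding multiplication_rank_def system_mults_def num_mults_def
proof (intro INF_greatest)
  fix R S k
  assume R: "R \<in> {R. complete_system G R}"
    and S: "S \<in> {S. finite S \<and> S \<subseteq> lists (arcs G) \<and> relation_seqs R \<subseteq> S}"
    and k: "k \<in> {k. (multiplication_step ^^ k) (short_seqs G) S}"
  have "{p. minimally_ambiguous G p} \<subseteq> S"
    using minimally_ambiguous_in_relation_seqs[OF G] R S by blast
  with T have TS: "T \<subseteq> consecutive_pairs S"
    by (auto simp: consecutive_pairs_def)
  have "consecutive_pairs (short_seqs G) = {}"
    by (auto simp: consecutive_pairs_def short_seqs_def sublist_Cons_right)
  with k card_consecutive_pairs_le[of k "short_seqs G" S]
  have "finite (consecutive_pairs S)" "card (consecutive_pairs S) \<le> k"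
    by auto
  with card_mono[OF _ TS] show "enat (card T) \<le> enat k"
    by simp
qed

section \<open>Layered graphs\<close>

text \<open>
  Vertices are numbered layer by layer: \<open>{..<p}\<close>, then \<open>{p..<p + q}\<close>, then
  \<open>{p + q..<2 * p + q}\<close>, followed by isolated vertices.  Indices \<open>a\<close>, \<open>b\<close>, \<open>c\<close> count from zero
  inside the first, middle and last layer.  Edges are numbered in radix \<open>q\<close>, with the index of the
  vertex in the middle layer as the last digit.
\<close>

definition first_arc :: "nat \<Rightarrow> nat \<Rightarrow> nat \<Rightarrow> nat" where
  "first_arc q a b = a * q + b"

definition second_arc :: "nat \<Rightarrow> nat \<Rightarrow> nat \<Rightarrow> nat \<Rightarrow> nat" where
  "second_arc p q b c = p * q + (c * q + b)"

text \<open>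
  The surplus edges run from the first vertex of the first layer directly to the first vertex of the
  last layer.  They create further parallel paths but neither replace nor extend the paths of
  length two.  Loops would not do, since they make the empty path ambiguous.
\<close>

definition layered_graph :: "nat \<Rightarrow> nat \<Rightarrow> nat \<Rightarrow> nat \<Rightarrow> (nat, nat) pre_digraph" where
  "layered_graph n m p q = \<lparr>verts = {..<n}, arcs = {..<m},
    tail = (\<lambda>e. if e < p * q then e div q
      else if e < 2 * (p * q) then p + (e - p * q) mod q else 0),
    head = (\<lambda>e. if e < p * q then p + e mod q
      else if e < 2 * (p * q) then p + q + (e - p * q) div q else p + q)\<rparr>"

lemma mixed_radix_less:
  fixes a b p q :: nat
  assumes "a < p" "b < q"
  shows "a * q + b < p * q"
proof -
  have "a * q + b < Suc a * q" using assms by simp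
  also have "\<dots> \<le> p * q" using assms by (intro mult_right_mono) auto
  finally show ?thesis .
qed

context
  fixes n m p q :: nat
  assumes p: "p > 0" and q: "q \<ge> 2" and n: "2 * p + q \<le> n" and m: "2 * (p * q) \<le> m"
begin

abbreviation "LG \<equiv> layered_graph n m p q"

lemma first_arc_ends:
  assumes "a < p" "b < q"
  shows "first_arc q a b < p * q" "tail LG (first_arc q a b) = a" "head LG (first_arc q a b) = p + b"
  using mixed_radix_less[OF assms] assms by (auto simp: first_arc_def layered_graph_def)

lemma second_arc_ends:
  assumes "c < p" "b < q"
  shows "second_arc p q b c < 2 * (p * q)"
    "tail LG (second_arc p q b c) = p + b" "head LG (second_arc p q b c) = p + q + c"
  using mixed_radix_less[OF assms] assms by (auto simp: second_arc_def layered_graph_def)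

lemma arc_cases:
  assumes "e \<in> arcs LG"
  obtains (first) a b where "a < p" "b < q" "e = first_arc q a b"
  | (second) b c where "b < q" "c < p" "e = second_arc p q b c"
  | (direct) "tail LG e = 0" "head LG e = p + q"
proof -
  have div_less: "x div q < p" if "x < p * q" for x
    using that by (simp add: less_mult_imp_div_less)
  consider "e < p * q" | "p * q \<le> e" "e < 2 * (p * q)" | "2 * (p * q) \<le> e" by linarith
  then show thesis
  proof cases
    case 1
    show ?thesis
      by (rule first[of "e div q" "e mod q"]) (use 1 q div_less in \<open>auto simp: first_arc_def\<close>)
  next
    case 2
    show ?thesis
      by (rule second[of "(e - p * q) mod q" "(e - p * q) div q"])
        (use 2 q div_less in \<open>auto simp: second_arc_def\<close>)
  next
    case 3
    then show ?thesis by (intro direct) (auto simp: layered_graph_def)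
  qed
qed

lemma oriented_graph_layered: "oriented_graph LG"
proof unfold_locales
  fix e assume "e \<in> arcs LG"
  then have "tail LG e < n \<and> head LG e < n"
    by (cases rule: arc_cases) (use n p q in \<open>auto simp: first_arc_ends second_arc_ends\<close>)
  then show "tail LG e \<in> verts LG" "head LG e \<in> verts LG"
    by (simp_all add: layered_graph_def)
next
  have "0 < n" "0 < p * q" using p q n by auto
  with m have "0 < m" by linarith
  with \<open>0 < n\<close> show "verts LG \<noteq> {}" "arcs LG \<noteq> {}"
    by (auto simp: layered_graph_def)
qed (simp_all add: layered_graph_def)

interpretation oriented_graph LG
  by (rule oriented_graph_layered)

lemma tail_less_head:
  assumes "e \<in> arcs LG"
  shows "tail LG e < head LG e"
  using assms p q by (cases rule: arc_cases) (auto simp: first_arc_ends second_arc_ends)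

lemma tail_less_last_layer:
  assumes "e \<in> arcs LG"
  shows "tail LG e < p + q"
  using assms p q by (cases rule: arc_cases) (auto simp: first_arc_ends second_arc_ends)

text \<open>
  Edges increase the vertex number, so there are no closed walks other than the empty ones.
\<close>

lemma awalk_ends_le:
  "awalk u w v \<Longrightarrow> u \<le> v \<and> (u = v \<longrightarrow> w = [])"
proof (induction w arbitrary: u)
  case (Cons e w)
  then have "e \<in> arcs LG" "u = tail LG e" "head LG e \<le> v"
    by (auto simp: awalk_Cons_iff)
  with tail_less_head[of e] show ?case by simp
qed (simp add: awalk_Nil_iff)

lemma awalk_from_last_layer:
  assumes "awalk u w v" "p + q \<le> u"
  shows "w = []"
proof (cases w)
  case (Cons e w')
  then have "e \<in> arcs LG" "u = tail LG e" using assms(1) by (auto simp: awalk_Cons_iff)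
  then show ?thesis using tail_less_last_layer[of e] assms(2) by simp
qed

lemma not_ambiguous_Nil: "\<not> ambiguous LG []"
  using awalk_ends_le by (auto simp: ambiguous_def awalk_Nil_iff)

text \<open>
  A walk that ends in the middle layer has never left the first two layers, and so it cannot contain a
  second edge.
\<close>

lemma not_ambiguous_first_arc:
  assumes ab: "a < p" "b < q"
  shows "\<not> ambiguous LG [first_arc q a b]"
proof
  assume "ambiguous LG [first_arc q a b]"
  then obtain w where w: "awalk a w (p + b)" and ne: "w \<noteq> [first_arc q a b]"
    by (auto simp: ambiguous_def awalk_Cons_iff awalk_Nil_iff first_arc_ends ab)
  from w ab obtain e w' where w': "w = e # w'"
    by (cases w) (auto simp: awalk_Nil_iff)
  with w have e: "e \<in> arcs LG" "tail LG e = a" and rest: "awalk (head LG e) w' (p + b)"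
    by (auto simp: awalk_Cons_iff)
  have le: "head LG e \<le> p + b" using awalk_ends_le[OF rest] by simp
  from e(1) show False
  proof (cases rule: arc_cases)
    case (first a' b')
    then have "a' = a" using e by (simp add: first_arc_ends)
    moreover have "w' = []"
    proof (cases w')
      case (Cons f w'')
      then have f: "f \<in> arcs LG" "tail LG f = p + b'" "head LG f \<le> p + b"
        using rest first awalk_ends_le by (auto simp: awalk_Cons_iff first_arc_ends)
      from f(1) show ?thesis
        by (cases rule: arc_cases) (use f p ab in \<open>auto simp: first_arc_ends second_arc_ends\<close>)
    qed
    ultimately show False
      using rest first ne w' by (auto simp: awalk_Nil_iff first_arc_ends)
  qed (use e le ab in \<open>auto simp: second_arc_ends\<close>)
qed

text \<open>
  A walk that starts in the middle layer reaches the last layer with its first edge and stops there.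
\<close>

lemma not_ambiguous_second_arc:
  assumes bc: "b < q" "c < p"
  shows "\<not> ambiguous LG [second_arc p q b c]"
proof
  assume "ambiguous LG [second_arc p q b c]"
  then obtain w where w: "awalk (p + b) w (p + q + c)" and ne: "w \<noteq> [second_arc p q b c]"
    by (auto simp: ambiguous_def awalk_Cons_iff awalk_Nil_iff second_arc_ends bc)
  from w bc obtain e w' where w': "w = e # w'"
    by (cases w) (auto simp: awalk_Nil_iff)
  with w have e: "e \<in> arcs LG" "tail LG e = p + b" and rest: "awalk (head LG e) w' (p + q + c)"
    by (auto simp: awalk_Cons_iff)
  from e(1) show False
  proof (cases rule: arc_cases)
    case (second b' c')
    then have "b' = b" using e by (simp add: second_arc_ends)
    moreover have "w' = []"
      using awalk_from_last_layer[OF rest] second by (simp add: second_arc_ends)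
    ultimately show False
      using rest second ne w' by (auto simp: awalk_Nil_iff second_arc_ends)
  qed (use e p in \<open>auto simp: first_arc_ends\<close>)
qed

text \<open>
  The rival path takes a detour through another vertex \<open>b'\<close> of the middle layer, which is where
  \<open>q \<ge> 2\<close> enters.
\<close>

lemma minimally_ambiguous_two_arcs:
  assumes abc: "a < p" "b < q" "c < p"
  shows "minimally_ambiguous LG [first_arc q a b, second_arc p q b c]"
proof -
  have walk: "awalk a [first_arc q a b', second_arc p q b' c] (p + q + c)" if "b' < q" for b'
  proof -
    have "first_arc q a b' < m" "second_arc p q b' c < m"
      using first_arc_ends(1)[of a b'] second_arc_ends(1)[of c b'] that abc m by auto
    then show ?thesis
      using that abc n
      by (auto simp: awalk_Cons_iff awalk_Nil_iff first_arc_ends second_arc_ends)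
        (auto simp: layered_graph_def)
  qed
  define b' where "b' = (if b = 0 then 1 else 0 :: nat)"
  have "b' < q" "b' \<noteq> b" using q by (auto simp: b'_def)
  then have "ambiguous LG [first_arc q a b, second_arc p q b c]"
    using walk[of b] walk[of b'] abc unfolding ambiguous_def
    by (intro exI[of _ a] exI[of _ "p + q + c"]
        exI[of _ "[first_arc q a b', second_arc p q b' c]"]) (auto simp: first_arc_def)
  moreover have "\<not> ambiguous LG w"
    if "strict_sublist w [first_arc q a b, second_arc p q b c]" for w
  proof -
    have "w \<in> {[], [first_arc q a b], [second_arc p q b c]}"
      using that by (auto simp: strict_sublist_def sublist_Cons_right prefix_Cons)
    then show ?thesis
      using abc not_ambiguous_Nil not_ambiguous_first_arc not_ambiguous_second_arc by auto
  qed
  ultimately show ?thesis by (simp add: minimally_ambiguous_def)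
qed

theorem multiplication_rank_layered_ge:
  "enat (p * q * p) \<le> multiplication_rank LG"
proof -
  define pair where "pair = (\<lambda>(a, b, c). (first_arc q a b, second_arc p q b c))"
  define T where "T = pair ` ({..<p} \<times> {..<q} \<times> {..<p})"
  have "inj_on pair ({..<p} \<times> {..<q} \<times> {..<p})"
  proof (rule inj_onI, clarsimp simp: pair_def)
    fix a b c a' b' c'
    assume less: "a < p" "b < q" "c < p" "a' < p" "b' < q" "c' < p"
      and eq: "first_arc q a b = first_arc q a' b'" "second_arc p q b c = second_arc p q b' c'"
    from arg_cong[OF eq(1), of "tail LG"] arg_cong[OF eq(1), of "head LG"]
      arg_cong[OF eq(2), of "head LG"]
    show "a = a' \<and> b = b' \<and> c = c'"
      using less by (simp add: first_arc_ends second_arc_ends)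
  qed
  then have "card T = p * q * p"
    by (simp add: T_def card_image card_cartesian_product)
  moreover have "T \<subseteq> consecutive_pairs {w. minimally_ambiguous LG w}"
    using minimally_ambiguous_two_arcs by (fastforce simp: T_def pair_def consecutive_pairs_def)
  ultimately show ?thesis
    using multiplication_rank_ge[OF oriented_graph_layered] by metis
qed

end

section \<open>Choice of the layer sizes\<close>

text \<open>
  Ignoring rounding, \<open>p = L / 4\<close> leaves half of the vertices for the middle layer, and
  \<open>q = K / (2 L)\<close> makes \<open>2 p q = K / 4\<close>.  The value \<open>q = 2\<close> is the fallback when
  \<open>K / L\<close> is small, in particular for \<open>m \<le> n\<close>, where \<open>K = L\<close>; it fits because \<open>4 p \<le> L\<close>.
\<close>

lemma layer_sizes_exist:
  fixes n m :: nat
  assumes n: "n \<ge> 4" and m: "m \<ge> 4"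
  obtains p q where "p > 0" "q \<ge> 2" "2 * p + q \<le> n" "2 * (p * q) \<le> m"
    "min (n\<^sup>2) m * min n m \<le> 256 * (p * q * p)"
proof -
  define K where "K = min (n\<^sup>2) m"
  define L where "L = min n m"
  define t where "t = K div L"
  define p where "p = L div 4"
  define q where "q = max 2 (t div 2)"
  have L: "4 \<le> L" "L \<le> n" "L \<le> m" using n m by (auto simp: L_def)
  have p: "0 < p" "4 * p \<le> L" "L \<le> 8 * p"
    using L unfolding p_def by presburger+
  have "t \<le> n"
  proof (cases "n \<le> m")
    case True
    then have "t \<le> n\<^sup>2 div n" by (auto simp: t_def K_def L_def intro: div_le_mono)
    then show ?thesis using n by (simp add: power2_eq_square)
  next
    case False
    then have "t \<le> m div m" by (auto simp: t_def K_def L_def intro: div_le_mono)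
    then show ?thesis using n m by simp
  qed
  then have q: "2 \<le> q" "2 * q \<le> n" "t + 1 \<le> 4 * q"
    using n by (auto simp: q_def)
  have "q * L \<le> 2 * m"
  proof (cases "t div 2 \<le> 2")
    case True
    then show ?thesis using L by (simp add: q_def)
  next
    case False
    have "q * L \<le> t * L" using False by (intro mult_right_mono) (auto simp: q_def)
    also have "\<dots> \<le> K" by (simp add: t_def)
    finally show ?thesis by (simp add: K_def)
  qed
  moreover have "q * (4 * p) \<le> q * L" using p by (intro mult_left_mono) auto
  ultimately have "q * (4 * p) \<le> 2 * m" by (rule order.trans[rotated])
  then have fits: "2 * (p * q) \<le> m" by (simp add: algebra_simps)
  \<comment> \<open>The factor 256 is \<open>4 * 8 * 8\<close>: rounding is absorbed in \<open>K / L \<le> 4 q\<close> and \<open>L \<le> 8 p\<close>.\<close>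
  have "K \<le> (t + 1) * L"
    using dividend_less_div_times[of L K] L by (simp add: t_def algebra_simps)
  also have "\<dots> \<le> 4 * q * (8 * p)" using q p by (intro mult_mono) auto
  finally have "K * L \<le> 4 * q * (8 * p) * (8 * p)" using p by (intro mult_mono) auto
  then have "min (n\<^sup>2) m * min n m \<le> 256 * (p * q * p)"
    by (simp add: K_def L_def algebra_simps)
  moreover have "2 * p + q \<le> n" using p q L by linarith
  ultimately show thesis using that p q fits by blast
qed

theorem theorem2p10:
  "\<exists>C::real. C > 0 \<and> C = 1 / 2 ^ 14 \<and>
    (\<forall>n m :: nat. n \<ge> 4 \<longrightarrow> m \<ge> 4 \<longrightarrow>
      (\<exists>G :: (nat, nat) pre_digraph.
        oriented_graph G \<and> card (verts G) = n \<and> card (arcs G) = m \<and>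
        ereal_of_enat (multiplication_rank G) \<ge>
          ereal (C * (real (min ((card (verts G))\<^sup>2) (card (arcs G))) *
                      real (min (card (verts G)) (card (arcs G)))))))"
proof (intro exI[of _ "1 / 2 ^ 14"] conjI allI impI)
  fix n m :: nat assume "n \<ge> 4" "m \<ge> 4"
  then obtain p q where pq: "p > 0" "q \<ge> 2" "2 * p + q \<le> n" "2 * (p * q) \<le> m"
    and le: "min (n\<^sup>2) m * min n m \<le> 256 * (p * q * p)"
    by (rule layer_sizes_exist)
  let ?G = "layered_graph n m p q"
  have card: "card (verts ?G) = n" "card (arcs ?G) = m"
    by (simp_all add: layered_graph_def)
  have "real (min (n\<^sup>2) m) * real (min n m) \<le> 256 * real (p * q * p)"
    using le by (metis of_nat_le_iff of_nat_mult of_nat_numeral)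
  also have "\<dots> \<le> 2 ^ 14 * real (p * q * p)"
    by (intro mult_right_mono) auto
  finally have "1 / 2 ^ 14 * (real (min (n\<^sup>2) m) * real (min n m)) \<le> real (p * q * p)"
    by (simp add: field_simps)
  then have "ereal (1 / 2 ^ 14 * (real (min (n\<^sup>2) m) * real (min n m))) \<le>
      ereal_of_enat (enat (p * q * p))"
    by simp
  also have "\<dots> \<le> ereal_of_enat (multiplication_rank ?G)"
    using multiplication_rank_layered_ge[OF pq] by (simp only: ereal_of_enat_le_iff)
  finally show "\<exists>G :: (nat, nat) pre_digraph.
        oriented_graph G \<and> card (verts G) = n \<and> card (arcs G) = m \<and>
        ereal_of_enat (multiplication_rank G) \<ge>
          ereal (1 / 2 ^ 14 * (real (min ((card (verts G))\<^sup>2) (card (arcs G))) *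
                      real (min (card (verts G)) (card (arcs G)))))"
    using oriented_graph_layered[OF pq] card by metis
qed simp_all

end
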